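(* For every integer $e\geq2$, the quantity $N_{\infty,e}:=\max\{q_e(y): y\in\mathbb{R}^{\mathcal{P}_e},\ \|y\|_1=1\}$ satisfies $$N_{\infty,e}=\frac{1}{2e}\left\lfloor\frac{e^2}{4}\right\rfloor.$$
   Context: $\mathcal{P}_e$ denotes the set of all subsets of $\{1,\dots,e\}$. For $E,F\in\mathcal{P}_e$ set $\mathsf{w}(E,F):=\min(|E|,|F|)-|E\cap F|$. The quadratic form $q_e$ on $\mathbb{R}^{\mathcal{P}_e}$ is $q_e(x):=\frac12\sum_{E,F\in\mathcal{P}_e}\mathsf{w}(E,F)\,x_Ex_F$, and $\|x\|_1:=\sum_{E\in\mathcal{P}_e}|x_E|$. *)

theory Defs
  imports Complex_Main "HOL-Library.FuncSet"
begin

abbreviation subsets_upto :: "nat \<Rightarrow> nat set set" where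
  "subsets_upto e \<equiv> Pow {1..e}"

(* Real vectors indexed by subsets_upto e; extensionality makes the representing function
   unique. *)
abbreviation vectors :: "nat \<Rightarrow> (nat set \<Rightarrow> real) set" where
  "vectors e \<equiv> extensional (subsets_upto e)"

definition w :: "nat set \<Rightarrow> nat set \<Rightarrow> real" where
  "w E F = real (min (card E) (card F)) - real (card (E \<inter> F))"

definition q :: "nat \<Rightarrow> (nat set \<Rightarrow> real) \<Rightarrow> real" where
  "q e x = 1/2 * (\<Sum>E\<in>subsets_upto e. \<Sum>F\<in>subsets_upto e. w E F * x E * x F)"

definition norm1 :: "nat \<Rightarrow> (nat set \<Rightarrow> real) \<Rightarrow> real" where
  "norm1 e x = (\<Sum>E\<in>subsets_upto e. \<bar>x E\<bar>)"

definition sphere_values :: "nat \<Rightarrow> real set" where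
  "sphere_values e = {q e y | y. y \<in> vectors e \<and> norm1 e y = 1}"

(* The greatest element of an infinite set of reals; it is unspecified when no greatest
   element exists, so that a statement about it has to assert attainment separately. *)
definition N_inf :: "nat \<Rightarrow> real" where
  "N_inf e = (GREATEST v. v \<in> sphere_values e)"

end

theory Submission
  imports Defs "HOL-Analysis.Convex"
begin

text \<open>
  The kernel splits as \<open>w E F = B E F + (card E * card F / e - card (E \<inter> F))\<close>, where
  \<open>B E F = min (card E) (card F) - card E * card F / e\<close>.

  The quadratic form of the bracket is never positive. If \<open>c t\<close> is the total weight that \<open>y\<close> gives
  to the sets containing \<open>t\<close>, then the two terms contribute \<open>(\<Sum>t. c t)\<^sup>2 / e\<close> and \<open>- (\<Sum>t. (c t)\<^sup>2)\<close>,
  so this is the Cauchy--Schwarz inequality, and equality holds when \<open>c\<close> is constant.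

  The entries of \<open>B\<close> depend on the cardinalities \<open>i \<le> j\<close> only: they equal \<open>i (e - j) / e\<close>, which is
  nonnegative and at most \<open>i (e - i) / e \<le> \<lfloor>e\<^sup>2 / 4\<rfloor> / e\<close>, since \<open>i (e - i)\<close> is an integer. Hence
  the quadratic form of \<open>B\<close> is at most \<open>\<lfloor>e\<^sup>2 / 4\<rfloor> / e\<close> on the unit sphere of the \<open>1\<close>-norm, whatever
  the signs of the coordinates are, and \<open>q\<close> is half of the quadratic form of \<open>w\<close>.

  Both estimates are sharp for the uniform weight on the subsets of cardinality \<open>k = e div 2\<close>: there
  \<open>c\<close> is constant by symmetry, and only entries of \<open>B\<close> with \<open>i = j = k\<close> occur.
\<close>

section \<open>Vertex weights and the intersection form\<close>

text \<open>The vertex weight \<open>c t\<close> of the argument above.\<close>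

definition vertex_weight :: "nat \<Rightarrow> (nat set \<Rightarrow> real) \<Rightarrow> nat \<Rightarrow> real" where
  "vertex_weight e y t = (\<Sum>E\<in>subsets_upto e. of_bool (t \<in> E) * y E)"

lemma real_card_eq_sum_of_bool:
  assumes "E \<in> subsets_upto e"
  shows "real (card E) = (\<Sum>t=1..e. of_bool (t \<in> E))"
proof -
  have "{1..e} \<inter> {t. t \<in> E} = E"
    using assms by auto
  then show ?thesis
    by simp
qed

lemma sum_card_eq_sum_vertex_weight:
  "(\<Sum>E\<in>subsets_upto e. real (card E) * y E) = (\<Sum>t=1..e. vertex_weight e y t)"
proof -
  have "(\<Sum>E\<in>subsets_upto e. real (card E) * y E)
      = (\<Sum>E\<in>subsets_upto e. \<Sum>t=1..e. of_bool (t \<in> E) * y E)"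
    by (intro sum.cong refl) (simp add: real_card_eq_sum_of_bool sum_distrib_right del: sum_of_bool_eq)
  also have "\<dots> = (\<Sum>t=1..e. vertex_weight e y t)"
    unfolding vertex_weight_def by (rule sum.swap)
  finally show ?thesis .
qed

text \<open>
  The matrix \<open>card (E \<inter> F)\<close> is the Gram matrix of the indicator vectors of the sets, so its
  quadratic form is the squared length of the combination of these vectors with coefficients \<open>y\<close>.
\<close>

lemma sum_card_Int_eq_sum_vertex_weight_squared:
  "(\<Sum>E\<in>subsets_upto e. \<Sum>F\<in>subsets_upto e. real (card (E \<inter> F)) * y E * y F)
    = (\<Sum>t=1..e. (vertex_weight e y t)\<^sup>2)"
proof -
  let ?g = "\<lambda>t E. of_bool (t \<in> E) * y E"
  have entry: "real (card (E \<inter> F)) * y E * y F = (\<Sum>t=1..e. ?g t E * ?g t F)"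
    if "E \<in> subsets_upto e" for E F
  proof -
    have "E \<inter> F \<in> subsets_upto e"
      using that by auto
    then have "real (card (E \<inter> F)) * y E * y F = (\<Sum>t=1..e. of_bool (t \<in> E \<inter> F) * y E * y F)"
      by (simp only: real_card_eq_sum_of_bool sum_distrib_right)
    also have "\<dots> = (\<Sum>t=1..e. ?g t E * ?g t F)"
      by (intro sum.cong) auto
    finally show ?thesis .
  qed
  have "(\<Sum>E\<in>subsets_upto e. \<Sum>F\<in>subsets_upto e. real (card (E \<inter> F)) * y E * y F)
      = (\<Sum>E\<in>subsets_upto e. \<Sum>F\<in>subsets_upto e. \<Sum>t=1..e. ?g t E * ?g t F)"
    by (intro sum.cong refl entry)
  also have "\<dots> = (\<Sum>E\<in>subsets_upto e. \<Sum>t=1..e. \<Sum>F\<in>subsets_upto e. ?g t E * ?g t F)"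
    by (intro sum.cong refl sum.swap)
  also have "\<dots> = (\<Sum>t=1..e. \<Sum>E\<in>subsets_upto e. \<Sum>F\<in>subsets_upto e. ?g t E * ?g t F)"
    by (rule sum.swap)
  also have "\<dots> = (\<Sum>t=1..e. (vertex_weight e y t)\<^sup>2)"
    by (simp only: vertex_weight_def power2_eq_square sum_product)
  finally show ?thesis .
qed

lemma q_eq_min_minus_vertex_weights:
  "2 * q e y = (\<Sum>E\<in>subsets_upto e. \<Sum>F\<in>subsets_upto e.
        real (min (card E) (card F)) * y E * y F)
      - (\<Sum>t=1..e. (vertex_weight e y t)\<^sup>2)"
  unfolding sum_card_Int_eq_sum_vertex_weight_squared[symmetric] q_def w_def
  by (simp add: left_diff_distrib sum_subtractf)

section \<open>The upper bound\<close>

text \<open>The integrality of \<open>i (e - i)\<close> is what allows the floor.\<close>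

lemma mult_diff_le_floor_quarter_square:
  assumes "i \<le> e"
  shows "real i * (real e - real i) \<le> real_of_int \<lfloor>(real e)\<^sup>2 / 4\<rfloor>"
proof -
  have "real i * (real e - real i) \<le> (real e)\<^sup>2 / 4"
    using zero_le_power2[of "real e - 2 * real i"] by (simp add: power2_eq_square algebra_simps)
  moreover have "real i * (real e - real i) = real_of_int (int (i * (e - i)))"
    using assms by (simp add: of_nat_diff)
  ultimately show ?thesis
    by (metis le_floor_iff of_int_le_iff)
qed

lemma floor_quarter_square_eq:
  fixes e :: nat
  shows "real_of_int \<lfloor>(real e)\<^sup>2 / 4\<rfloor> = real (e div 2) * (real e - real (e div 2))"
proof -
  define k where "k = e div 2"
  have "e = 2 * k \<or> e = 2 * k + 1"
    unfolding k_def by linarith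
  then have "\<lfloor>(real e)\<^sup>2 / 4\<rfloor> = int (k * (e - k))"
    by (intro floor_unique; elim disjE) (simp_all add: power2_eq_square field_simps)
  moreover have "k \<le> e"
    unfolding k_def by simp
  ultimately show ?thesis
    by (simp add: k_def of_nat_diff)
qed

text \<open>
  The bound is on the absolute value because the products of two coordinates of \<open>y\<close>, by which
  these entries are multiplied, may have either sign.
\<close>

lemma abs_min_minus_product_le:
  assumes "i \<le> e" "j \<le> e" "e > 0"
  shows "\<bar>real (min i j) - real i * real j / real e\<bar>
           \<le> real_of_int \<lfloor>(real e)\<^sup>2 / 4\<rfloor> / real e"
  using assms
proof (induction i j rule: linorder_wlog)
  case (le i j)
  then have "real (min i j) - real i * real j / real e = real i * (real e - real j) / real e"
    by (simp add: min_def field_simps)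
  moreover have "0 \<le> real i * (real e - real j) / real e"
    using le by simp
  moreover have "real i * (real e - real j) \<le> real i * (real e - real i)"
    using le by (intro mult_left_mono) auto
  then have "real i * (real e - real j) \<le> real_of_int \<lfloor>(real e)\<^sup>2 / 4\<rfloor>"
    using mult_diff_le_floor_quarter_square[OF \<open>i \<le> e\<close>] by linarith
  ultimately show ?case
    by (simp only: abs_of_nonneg) (simp add: divide_right_mono)
next
  case (sym i j)
  then show ?case
    by (simp add: min.commute mult.commute)
qed

lemma q_le_on_sphere:
  assumes "e > 0" "norm1 e y = 1"
  shows "q e y \<le> 1 / (2 * real e) * real_of_int \<lfloor>(real e)\<^sup>2 / 4\<rfloor>"
proof -
  let ?P = "subsets_upto e"
  let ?B = "\<lambda>E F. real (min (card E) (card F)) - real (card E) * real (card F) / real e"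
  let ?M = "real_of_int \<lfloor>(real e)\<^sup>2 / 4\<rfloor> / real e"
  have card_le: "card E \<le> e" if "E \<in> ?P" for E
    using card_mono[of "{1..e}" E] that by simp
  have "(\<Sum>E\<in>?P. \<Sum>F\<in>?P. ?B E F * y E * y F) \<le> (\<Sum>E\<in>?P. \<Sum>F\<in>?P. ?M * (\<bar>y E\<bar> * \<bar>y F\<bar>))"
  proof (intro sum_mono)
    fix E F assume "E \<in> ?P" "F \<in> ?P"
    then have "\<bar>?B E F\<bar> * (\<bar>y E\<bar> * \<bar>y F\<bar>) \<le> ?M * (\<bar>y E\<bar> * \<bar>y F\<bar>)"
      using assms(1) by (intro mult_right_mono abs_min_minus_product_le card_le) auto
    moreover have "?B E F * y E * y F \<le> \<bar>?B E F\<bar> * (\<bar>y E\<bar> * \<bar>y F\<bar>)"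
      using abs_ge_self[of "?B E F * y E * y F"] by (simp only: abs_mult mult.assoc)
    ultimately show "?B E F * y E * y F \<le> ?M * (\<bar>y E\<bar> * \<bar>y F\<bar>)"
      by (rule order_trans[rotated])
  qed
  also have "\<dots> = ?M * ((\<Sum>E\<in>?P. \<bar>y E\<bar>) * (\<Sum>F\<in>?P. \<bar>y F\<bar>))"
    unfolding sum_product by (simp only: sum_distrib_left)
  also have "\<dots> = ?M"
    using assms(2) by (simp add: norm1_def)
  finally have B_le: "(\<Sum>E\<in>?P. \<Sum>F\<in>?P. ?B E F * y E * y F) \<le> ?M" .
  have "(\<Sum>E\<in>?P. \<Sum>F\<in>?P. ?B E F * y E * y F)
      = (\<Sum>E\<in>?P. \<Sum>F\<in>?P. real (min (card E) (card F)) * y E * y F)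
        - (\<Sum>E\<in>?P. \<Sum>F\<in>?P. (real (card E) * y E) * (real (card F) * y F) / real e)"
    unfolding sum_subtractf[symmetric]
    by (intro sum.cong refl) (simp add: left_diff_distrib)
  also have "(\<Sum>E\<in>?P. \<Sum>F\<in>?P. (real (card E) * y E) * (real (card F) * y F) / real e)
      = (\<Sum>t=1..e. vertex_weight e y t)\<^sup>2 / real e"
    unfolding sum_card_eq_sum_vertex_weight[symmetric] power2_eq_square sum_product
    by (simp only: sum_divide_distrib)
  \<comment> \<open>The kernel is \<open>B\<close> plus the part controlled by Cauchy--Schwarz.\<close>
  finally have "2 * q e y = (\<Sum>E\<in>?P. \<Sum>F\<in>?P. ?B E F * y E * y F)
      + ((\<Sum>t=1..e. vertex_weight e y t)\<^sup>2 / real e - (\<Sum>t=1..e. (vertex_weight e y t)\<^sup>2))"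
    by (simp add: q_eq_min_minus_vertex_weights)
  moreover have "(\<Sum>t=1..e. vertex_weight e y t)\<^sup>2 / real e \<le> (\<Sum>t=1..e. (vertex_weight e y t)\<^sup>2)"
    using sum_squared_le_sum_of_squares[of "vertex_weight e y" "{1..e}"] assms(1)
    by (simp add: field_simps)
  ultimately show ?thesis
    using B_le by simp
qed

section \<open>Uniform weights on the subsets of a given cardinality\<close>

definition uniform_weight :: "nat \<Rightarrow> nat \<Rightarrow> nat set \<Rightarrow> real" where
  "uniform_weight e k =
    (\<lambda>E\<in>subsets_upto e. if card E = k then 1 / real (e choose k) else 0)"

lemma sum_uniform_weight:
  assumes "k \<le> e"
  shows "(\<Sum>E\<in>subsets_upto e. uniform_weight e k E) = 1"
proof -
  have "(\<Sum>E\<in>subsets_upto e. uniform_weight e k E)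
      = (\<Sum>E\<in>subsets_upto e. if E \<in> {E. card E = k} then 1 / real (e choose k) else 0)"
    by (simp add: uniform_weight_def)
  also have "\<dots> = (\<Sum>E\<in>subsets_upto e \<inter> {E. card E = k}. 1 / real (e choose k))"
    by (rule sum.inter_restrict[symmetric]) simp
  also have "subsets_upto e \<inter> {E. card E = k} = {E. E \<subseteq> {1..e} \<and> card E = k}"
    by auto
  finally show ?thesis
    using assms by (simp add: n_subsets)
qed

lemma norm1_uniform_weight:
  assumes "k \<le> e"
  shows "norm1 e (uniform_weight e k) = 1"
proof -
  have "\<bar>uniform_weight e k E\<bar> = uniform_weight e k E" if "E \<in> subsets_upto e" for E
    using that by (simp add: uniform_weight_def)
  then show ?thesis
    using sum_uniform_weight[OF assms] by (simp add: norm1_def)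
qed

text \<open>
  Among the \<open>e choose k\<close> subsets of cardinality \<open>k\<close>, those that avoid \<open>t\<close> are the subsets of an
  \<open>(e - 1)\<close>-element set, so \<open>(e - 1) choose (k - 1)\<close> of them contain \<open>t\<close>: a fraction \<open>k / e\<close>.
\<close>

lemma vertex_weight_uniform_weight:
  assumes "0 < k" "k \<le> e" "t \<in> {1..e}"
  shows "vertex_weight e (uniform_weight e k) t = real k / real e"
proof -
  let ?all = "{E. E \<subseteq> {1..e} \<and> card E = k}"
  let ?avoid = "{E. E \<subseteq> {1..e} - {t} \<and> card E = k}"
  have "vertex_weight e (uniform_weight e k) t
      = (\<Sum>E\<in>subsets_upto e. if E \<in> ?all - ?avoid then 1 / real (e choose k) else 0)"
    unfolding vertex_weight_def by (intro sum.cong) (auto simp: uniform_weight_def)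
  also have "\<dots> = (\<Sum>E\<in>subsets_upto e \<inter> (?all - ?avoid). 1 / real (e choose k))"
    by (rule sum.inter_restrict[symmetric]) simp
  also have "subsets_upto e \<inter> (?all - ?avoid) = ?all - ?avoid"
    by auto
  also have "(\<Sum>E\<in>?all - ?avoid. 1 / real (e choose k))
      = real (card (?all - ?avoid)) / real (e choose k)"
    by simp
  also have "card (?all - ?avoid) = (e choose k) - ((e - 1) choose k)"
    using assms(3) by (subst card_Diff_subset) (auto simp: n_subsets)
  also have "\<dots> = (e - 1) choose (k - 1)"
    using assms choose_reduce_nat[of e k] by simp
  also have "real ((e - 1) choose (k - 1)) / real (e choose k) = real k / real e"
    using times_binomial_minus1_eq[OF \<open>0 < k\<close>, of e] assms
    by (simp add: frac_eq_eq mult.commute flip: of_nat_mult)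
  finally show ?thesis .
qed

lemma q_uniform_weight:
  assumes "0 < k" "k \<le> e"
  shows "q e (uniform_weight e k) = real k * (real e - real k) / (2 * real e)"
proof -
  let ?P = "subsets_upto e" and ?u = "uniform_weight e k"
  have "(\<Sum>E\<in>?P. \<Sum>F\<in>?P. real (min (card E) (card F)) * ?u E * ?u F)
      = (\<Sum>E\<in>?P. \<Sum>F\<in>?P. real k * (?u E * ?u F))"
    by (intro sum.cong refl) (simp add: uniform_weight_def)
  also have "\<dots> = real k * ((\<Sum>E\<in>?P. ?u E) * (\<Sum>F\<in>?P. ?u F))"
    unfolding sum_product by (simp only: sum_distrib_left)
  also have "\<dots> = real k"
    using sum_uniform_weight[OF assms(2)] by simp
  finally have "2 * q e ?u = real k - (\<Sum>t=1..e. (real k / real e)\<^sup>2)"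
    using assms by (simp add: q_eq_min_minus_vertex_weights vertex_weight_uniform_weight)
  then show ?thesis
    using assms by (simp add: power2_eq_square field_simps)
qed

section \<open>The maximum\<close>

theorem corollary3p53:
  fixes e :: nat
  assumes "e \<ge> 2"
  shows "N_inf e \<in> sphere_values e
    \<and> (\<forall>v\<in>sphere_values e. v \<le> N_inf e)
    \<and> N_inf e = 1 / (2 * real e) * real_of_int \<lfloor>(real e)\<^sup>2 / 4\<rfloor>"
proof -
  let ?N = "1 / (2 * real e) * real_of_int \<lfloor>(real e)\<^sup>2 / 4\<rfloor>"
  let ?u = "uniform_weight e (e div 2)"
  have upper: "v \<le> ?N" if "v \<in> sphere_values e" for v
    using that q_le_on_sphere assms by (auto simp: sphere_values_def)
  have "q e ?u = ?N"
    using assms by (subst q_uniform_weight) (auto simp: floor_quarter_square_eq)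
  moreover have "?u \<in> vectors e"
    by (simp add: uniform_weight_def)
  moreover have "norm1 e ?u = 1"
    by (simp add: norm1_uniform_weight)
  ultimately have attained: "?N \<in> sphere_values e"
    unfolding sphere_values_def by (intro CollectI exI[of _ ?u]) simp
  have "N_inf e = ?N"
    unfolding N_inf_def using attained upper by (intro Greatest_equality) auto
  then show ?thesis
    using attained upper by simp
qed

end
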